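(* In the static crowd-sensing scenario without PoI preference, given the set $S_i=\{s_1,\dots,s_i\}\subseteq V$ of selected users, $$\Phi(S_i)=\frac1m\,\mathbf e^T\mathbf C_i\,\mathbf e-\frac1{2m}\sum_{v_x\in V}\mathbf e_x^T\,\mathbf M_{\sigma_x(\mathbf B_i)}\,\mathbf e_x,$$ where $\mathbf e$ and $\mathbf e_x$ are both all-ones column vectors (of dimensions suitable for the multiplication).
   Context: Setting. The sensing graph is a finite undirected graph without self-loops $G_1=(V\cup V',E_1)$, where $V=\{v_1,\dots,v_m\}$ is the set of user nodes and $V'$ the set of nodes without users; $\varpi=|V\cup V'|$, and all nodes are indexed $v_1,\dots,v_\varpi$. The social graph is an undirected graph $G_2=(V,E_2)$; $N_2(v)$ is the set of neighbours of $v$ in $G_2$. For a node set $\overline V$, $E_1(\overline V)$ is the set of edges of $G_1$ incident to at least one node of $\overline V$. For $S\subseteq V$, $\phi_i(S)=|E_1(\{v_i\}\cup N_2(v_i)\cup S)|$ and $\Phi(S)=\frac1m\sum_{v_i\in V}\phi_i(S)$. Matrices. $\mathbf A=(a_{i,j})$ is the $\varpi\times\varpi$ matrix with $a_{i,j}=1$ if $i\ne j$ and $(v_i,v_j)\in E_1$, and $a_{i,j}=0$ otherwise. $\mathbf B=(b_{i,j})$ is the $\varpi\times\varpi$ matrix with $b_{i,j}=1$ if $v_i,v_j\in V$ and ($(v_i,v_j)\in E_2$ or $i=j$), and $b_{i,j}=0$ otherwise. Put $\mathbf B_0=\mathbf B$; if the $i$-th selected user is $s_i=v_h$, then $\mathbf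 B_i$ is obtained from $\mathbf B_{i-1}$ by setting all entries of the $h$-th row to $1$, the other rows being unchanged (in particular, the entries of the $h$-th column outside the $h$-th row remain unchanged). Put $\mathbf C_i=\mathbf A\mathbf B_i$. For $v_x\in V$, $\sigma_x(\mathbf B_i)$ is the set of indices of the zero entries in the $x$-th column of $\mathbf B_i$, and $\mathbf M_{\sigma_x(\mathbf B_i)}$ is the submatrix of $\mathbf A$ obtained by deleting the rows and columns indexed by $\sigma_x(\mathbf B_i)$.
   Formalization: When v_h is selected, the h-th row of B is set to 1 only in the columns of user nodes, not in all columns; columns of nodes in V' stay 0, since otherwise the formula fails (e.g. V={v1}, V'={v2}, one edge, S={v1} gives 1 = 2). *)

theory Defs
  imports Complex_Main "Jordan_Normal_Form.Matrix" "Jordan_Normal_Form.DL_Submatrix"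
begin

(* Edges of an undirected graph are the sets {a, b}.  The sensing graph has no self-loops. *)

definition sensing_graph :: "'a set \<Rightarrow> 'a set set \<Rightarrow> bool" where
  "sensing_graph N E1 \<longleftrightarrow>
     finite N \<and> (\<forall>e\<in>E1. \<exists>a\<in>N. \<exists>b\<in>N. a \<noteq> b \<and> e = {a, b})"

definition social_graph :: "'a set \<Rightarrow> 'a set set \<Rightarrow> bool" where
  "social_graph V E2 \<longleftrightarrow> (\<forall>e\<in>E2. \<exists>a\<in>V. \<exists>b\<in>V. e = {a, b})"

definition neighbours :: "'a set set \<Rightarrow> 'a \<Rightarrow> 'a set" where
  "neighbours E a = {b. {a, b} \<in> E}"

definition incident_edges :: "'a set set \<Rightarrow> 'a set \<Rightarrow> 'a set set" where
  "incident_edges E U = {e \<in> E. e \<inter> U \<noteq> {}}"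

definition phi :: "'a set set \<Rightarrow> 'a set set \<Rightarrow> 'a set \<Rightarrow> 'a \<Rightarrow> nat" where
  "phi E1 E2 S x = card (incident_edges E1 ({x} \<union> neighbours E2 x \<union> S))"

definition Phi :: "'a set \<Rightarrow> 'a set set \<Rightarrow> 'a set set \<Rightarrow> 'a set \<Rightarrow> real" where
  "Phi V E1 E2 S = 1 / real (card V) * (\<Sum>x\<in>V. real (phi E1 E2 S x))"

(* Below, v 0, ..., v (w - 1) enumerates all nodes, so matrix indices start from 0. *)

definition A_mat :: "nat \<Rightarrow> (nat \<Rightarrow> 'a) \<Rightarrow> 'a set set \<Rightarrow> real mat" where
  "A_mat w v E1 =
     mat w w (\<lambda>(i, j). if i \<noteq> j \<and> {v i, v j} \<in> E1 then 1 else 0)"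

(* The selected users are s 1, s 2, ....  Selecting the user v h sets the entries (h, c) to 1
   for all user columns c.  The columns of nodes without users stay zero, as in the initial
   matrix: they describe no user, and filling them would add the degree of v h to the sum of
   all entries of A * B once per node without user.  For example, with V = {p}, V' = {q} and
   the single edge {p, q}, selecting p would then turn the value 1 into 2.  If every node is
   a user, the whole row is set to 1. *)

primrec B_mat ::
  "nat \<Rightarrow> (nat \<Rightarrow> 'a) \<Rightarrow> 'a set \<Rightarrow> 'a set set \<Rightarrow> (nat \<Rightarrow> 'a) \<Rightarrow> nat \<Rightarrow> real mat" where
  "B_mat w v V E2 s 0 =
     mat w w (\<lambda>(r, c). if v r \<in> V \<and> v c \<in> V \<and> ({v r, v c} \<in> E2 \<or> r = c) then 1 else 0)"
| "B_mat w v V E2 s (Suc i) =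
     mat w w (\<lambda>(r, c). if v r = s (Suc i) \<and> v c \<in> V then 1 else B_mat w v V E2 s i $$ (r, c))"

definition C_mat ::
  "nat \<Rightarrow> (nat \<Rightarrow> 'a) \<Rightarrow> 'a set \<Rightarrow> 'a set set \<Rightarrow> 'a set set \<Rightarrow> (nat \<Rightarrow> 'a) \<Rightarrow> nat \<Rightarrow> real mat" where
  "C_mat w v V E1 E2 s i = A_mat w v E1 * B_mat w v V E2 s i"

definition zero_indices :: "nat \<Rightarrow> real mat \<Rightarrow> nat set" where
  "zero_indices x B = {r. r < dim_row B \<and> B $$ (r, x) = 0}"

definition delete_indices :: "nat set \<Rightarrow> real mat \<Rightarrow> real mat" where
  "delete_indices I A = submatrix A ({..<dim_row A} - I) ({..<dim_col A} - I)"

definition ones_vec :: "nat \<Rightarrow> real vec" where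
  "ones_vec n = vec n (\<lambda>_. 1)"

(* e^T M e, where the all-ones vectors take their dimensions from M *)
definition ones_form :: "real mat \<Rightarrow> real" where
  "ones_form M = ones_vec (dim_row M) \<bullet> (M *\<^sub>v ones_vec (dim_col M))"

end

theory Submission
  imports Defs
begin

text \<open>
  For a fixed user \<open>x\<close>, the nonzero entries of column \<open>x\<close> of \<open>B\<close> mark the set \<open>U\<close> consisting of
  \<open>x\<close>, its neighbours and the selected users. Column \<open>x\<close> of \<open>A * B\<close> thus contributes the sum of the
  degrees over \<open>U\<close>, which counts the edges inside \<open>U\<close> twice; the submatrix of \<open>A\<close> on \<open>U\<close>
  has entry sum equal to twice the number of those edges.
\<close>

lemma sensing_graphD:
  assumes "sensing_graph N E"
  shows "finite N" "finite E" "{a, b} \<in> E \<Longrightarrow> a \<in> N \<and> b \<in> N \<and> a \<noteq> b"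
proof -
  show N: "finite N"
    using assms by (auto simp: sensing_graph_def)
  have "E \<subseteq> Pow N"
    using assms by (fastforce simp: sensing_graph_def)
  then show "finite E"
    using N by (meson finite_Pow_iff finite_subset)
  assume "{a, b} \<in> E"
  then obtain c d where "c \<in> N" "d \<in> N" "c \<noteq> d" "{a, b} = {c, d}"
    using assms unfolding sensing_graph_def by blast
  then show "a \<in> N \<and> b \<in> N \<and> a \<noteq> b"
    by (auto simp: doubleton_eq_iff)
qed

text \<open>Grouping the ordered pairs by the edge they span gives fibres of size exactly two,
  \<open>(a, b)\<close> and \<open>(b, a)\<close>. These are distinct because there are no
  self-loops.\<close>

lemma card_adjacent_pairs:
  assumes E: "sensing_graph N E" and F: "F \<subseteq> E"
  shows "card {p \<in> N \<times> N. {fst p, snd p} \<in> F} = 2 * card F"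
proof -
  let ?P = "{p \<in> N \<times> N. {fst p, snd p} \<in> F}"
  have "finite ?P" "finite F"
    using sensing_graphD(1,2)[OF E] F finite_subset by auto
  have fibre: "card {p \<in> ?P. {fst p, snd p} = e} = 2" if "e \<in> F" for e
  proof -
    obtain a b where ab: "a \<in> N" "b \<in> N" "a \<noteq> b" "e = {a, b}"
      using E F \<open>e \<in> F\<close> unfolding sensing_graph_def by blast
    then have "{p \<in> ?P. {fst p, snd p} = e} = {(a, b), (b, a)}"
      using \<open>e \<in> F\<close> by (auto simp: doubleton_eq_iff insert_commute)
    with ab show ?thesis
      by simp
  qed
  have "card ?P = (\<Sum>e\<in>F. \<Sum>p\<in>{p \<in> ?P. {fst p, snd p} = e}. 1)"
    using sum.group[OF \<open>finite ?P\<close> \<open>finite F\<close>, of "\<lambda>p. {fst p, snd p}" "\<lambda>_. 1::nat"]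
    by fastforce
  also have "\<dots> = 2 * card F"
    using fibre by simp
  finally show ?thesis .
qed

text \<open>Twice the edge count is a count of ordered pairs, to which inclusion-exclusion applies:
  the first node lies in \<open>U\<close>, or the second does, minus both. The first two counts
  agree by symmetry, and halving gives the formula.\<close>

lemma card_incident_edges:
  assumes E: "sensing_graph N E" and U: "U \<subseteq> N"
  shows "real (card (incident_edges E U)) =
    (\<Sum>a\<in>N. \<Sum>b\<in>U. of_bool ({a, b} \<in> E)) - (\<Sum>a\<in>U. \<Sum>b\<in>U. of_bool ({a, b} \<in> E)) / 2"
proof -
  let ?f = "\<lambda>a b. of_bool ({a, b} \<in> E) :: real"
  let ?u = "\<lambda>a. of_bool (a \<in> U) :: real"
  have N: "finite N"
    using sensing_graphD(1)[OF E] .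
  have restrict: "(\<Sum>a\<in>N. ?u a * g a) = (\<Sum>a\<in>U. g a)" for g
    using N U by (simp add: of_bool_def if_distrib[of "\<lambda>y. y * _"] sum.If_cases Int_absorb1 cong: if_cong)
  have "2 * real (card (incident_edges E U)) =
      card {p \<in> N \<times> N. {fst p, snd p} \<in> incident_edges E U}"
    using card_adjacent_pairs[OF E, of "incident_edges E U"] by (simp add: incident_edges_def)
  also have "\<dots> = (\<Sum>p\<in>N \<times> N. of_bool ({fst p, snd p} \<in> incident_edges E U))"
    using N by (simp add: of_bool_def sum.If_cases Int_def)
  also have "\<dots> = (\<Sum>a\<in>N. \<Sum>b\<in>N. of_bool ({a, b} \<in> incident_edges E U))"
    by (simp add: sum.cartesian_product split_def)
  \<comment> \<open>Inclusion-exclusion as an identity of indicators. The products are arranged so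
    that \<open>restrict\<close> can turn each factor \<open>?u\<close> into a sum over
    \<open>U\<close>.\<close>
  also have "\<dots> = (\<Sum>a\<in>N. \<Sum>b\<in>N. ?u a * ?f a b + ?u b * ?f a b - ?u a * (?u b * ?f a b))"
    by (intro sum.cong) (auto simp: incident_edges_def)
  also have "\<dots> = (\<Sum>a\<in>U. \<Sum>b\<in>N. ?f a b) + (\<Sum>a\<in>N. \<Sum>b\<in>U. ?f a b) - (\<Sum>a\<in>U. \<Sum>b\<in>U. ?f a b)"
    by (simp add: sum.distrib sum_subtractf restrict flip: sum_distrib_left)
  also have "(\<Sum>a\<in>U. \<Sum>b\<in>N. ?f a b) = (\<Sum>a\<in>N. \<Sum>b\<in>U. ?f a b)"
    by (subst sum.swap) (simp add: insert_commute)
  finally show ?thesis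
    by simp
qed

lemma ones_form_eq_sum: "ones_form M = (\<Sum>a<dim_row M. \<Sum>b<dim_col M. M $$ (a, b))"
  by (simp add: ones_form_def ones_vec_def scalar_prod_def lessThan_atLeast0)

text \<open>\<open>pick I\<close> enumerates \<open>I\<close> in increasing order, hence
  injectively; an injective image in \<open>I\<close> of the same finite cardinality is all of
  \<open>I\<close>.\<close>

lemma bij_betw_pick:
  assumes "finite I"
  shows "bij_betw (pick I) {..<card I} I"
proof -
  have "inj_on (pick I) {..<card I}"
    by (rule linorder_inj_onI) (auto simp: less_imp_neq pick_mono)
  moreover have "pick I ` {..<card I} \<subseteq> I"
    by (auto simp: pick_in_set)
  ultimately show ?thesis
    using assms by (simp add: bij_betw_def card_image card_subset_eq)
qed

text \<open>The sum of all entries does not depend on how \<open>submatrix\<close> renumbers the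
  remaining rows and columns, so \<open>pick\<close> can be eliminated by reindexing.\<close>

lemma ones_form_delete_indices:
  "ones_form (delete_indices I M) =
    (\<Sum>a\<in>{..<dim_row M} - I. \<Sum>b\<in>{..<dim_col M} - I. M $$ (a, b))"
proof -
  let ?R = "{..<dim_row M} - I" and ?C = "{..<dim_col M} - I"
  have R: "{a. a < dim_row M \<and> a \<in> ?R} = ?R" and C: "{a. a < dim_col M \<and> a \<in> ?C} = ?C"
    by auto
  have "ones_form (delete_indices I M) =
      (\<Sum>a<card ?R. \<Sum>b<card ?C. M $$ (pick ?R a, pick ?C b))"
    unfolding ones_form_eq_sum delete_indices_def submatrix_def R C by simp
  also have "\<dots> = (\<Sum>a<card ?R. \<Sum>b\<in>?C. M $$ (pick ?R a, b))"
    by (intro sum.cong refl sum.reindex_bij_betw bij_betw_pick) auto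
  also have "\<dots> = (\<Sum>a\<in>?R. \<Sum>b\<in>?C. M $$ (a, b))"
    by (intro sum.reindex_bij_betw[where g = "\<lambda>a. \<Sum>b\<in>_. M $$ (a, b)"] bij_betw_pick) auto
  finally show ?thesis .
qed

lemma dim_B_mat [simp]:
  "dim_row (B_mat w v V E s i) = w" "dim_col (B_mat w v V E s i) = w"
  by (cases i; simp)+

text \<open>By induction on the number of selections: in every user column, filling the row of
  \<open>s (Suc i)\<close> adds this node to the marked set. Initially, injectivity of
  \<open>v\<close> translates \<open>r = c\<close> into equality of nodes, and edges of the social
  graph only join users.\<close>

lemma B_mat_entry:
  assumes "social_graph V E" and inj: "inj_on v {..<w}" and "\<forall>k\<in>{1..i}. s k \<in> V"
    and "r < w" "c < w"
  shows "B_mat w v V E s i $$ (r, c) =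
    of_bool (v c \<in> V \<and> v r \<in> {v c} \<union> neighbours E (v c) \<union> s ` {1..i})"
  using assms(3)
proof (induction i)
  case 0
  have "v r \<in> V \<and> v c \<in> V" if "{v r, v c} \<in> E"
    using that assms(1) by (force simp: social_graph_def doubleton_eq_iff)
  moreover have "v r = v c \<longleftrightarrow> r = c"
    using inj assms(4,5) by (simp add: inj_on_eq_iff)
  ultimately show ?case
    using assms(4,5) by (auto simp: neighbours_def insert_commute)
next
  case (Suc i)
  then show ?case
    using assms(4,5) by (auto simp: atLeastAtMostSuc_conv)
qed

theorem theorem4:
  fixes V V' :: "'a set" and E1 E2 :: "'a set set"
    and v s :: "nat \<Rightarrow> 'a" and m w i :: nat
  assumes sensing: "sensing_graph (V \<union> V') E1"
    and disjoint: "V \<inter> V' = {}"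
    and social: "social_graph V E2"
    and users: "bij_betw v {..<m} V"
    and nodes: "bij_betw v {..<w} (V \<union> V')"
    and m_pos: "m \<ge> 1"
    and selected: "\<forall>k\<in>{1..i}. s k \<in> V"
  shows "Phi V E1 E2 (s ` {1..i}) =
    1 / real m * ones_form (C_mat w v V E1 E2 s i)
    - 1 / (2 * real m) *
        (\<Sum>x<m. ones_form (delete_indices (zero_indices x (B_mat w v V E2 s i)) (A_mat w v E1)))"
proof -
  let ?N = "V \<union> V'" and ?A = "A_mat w v E1" and ?B = "B_mat w v V E2 s i"
  let ?f = "\<lambda>a b. of_bool ({a, b} \<in> E1) :: real"
  \<comment> \<open>\<open>U x\<close> consists of nodes, as used in \<open>phi\<close>;
    \<open>R x\<close> is the corresponding set of matrix indices.\<close>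
  define U where "U x = {v x} \<union> neighbours E2 (v x) \<union> s ` {1..i}" for x
  define R where "R x = {r. r < w \<and> v r \<in> U x}" for x
  have inj: "inj_on v {..<w}" and vw: "v ` {..<w} = ?N" and vm: "v ` {..<m} = V"
    using nodes users by (auto simp: bij_betw_def)
  have cardV: "card V = m"
    using bij_betw_same_card[OF users] by simp
  have "m \<le> w"
    using cardV bij_betw_same_card[OF nodes] sensing_graphD(1)[OF sensing]
      card_mono[of ?N V] by simp
  \<comment> \<open>The users occupy exactly the first \<open>m\<close> indices, since
    \<open>v\<close> is injective below \<open>w\<close> and maps \<open>{..<m}\<close> onto
    \<open>V\<close>.\<close>
  have user_iff: "v c \<in> V \<longleftrightarrow> c < m" if "c < w" for c
    using that vm inj \<open>m \<le> w\<close> inj_on_image_mem_iff[of v "{..<w}" c "{..<m}"] by auto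
  have UN: "U x \<subseteq> ?N" if "x < m" for x
    using that vm selected social
    by (fastforce simp: U_def neighbours_def social_graph_def doubleton_eq_iff)
  \<comment> \<open>The diagonal agrees with \<open>?f\<close> too, because
    \<open>{v a, v a}\<close> would be a self-loop.\<close>
  have A: "?A $$ (a, b) = ?f (v a) (v b)" if "a < w" "b < w" for a b
    using that sensing_graphD(3)[OF sensing, of "v a" "v a"] by (auto simp: A_mat_def)
  have B: "?B $$ (r, c) = of_bool (c < m \<and> r \<in> R c)" if "r < w" "c < w" for r c
    using that B_mat_entry[OF social inj selected] user_iff by (simp add: U_def R_def)
  have bijR: "bij_betw v (R x) (U x)" if "x < m" for x
    using UN[OF that] vw inj by (auto simp: R_def bij_betw_def inj_on_def image_iff)
  have phi_eq: "real (phi E1 E2 (s ` {1..i}) (v x)) =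
      (\<Sum>a<w. \<Sum>b\<in>R x. ?A $$ (a, b)) - (\<Sum>a\<in>R x. \<Sum>b\<in>R x. ?A $$ (a, b)) / 2" if "x < m" for x
  proof -
    \<comment> \<open>Needed for both sums of \<open>card_incident_edges\<close>: with all indices
      and all nodes, and with \<open>R x\<close> and \<open>U x\<close>.\<close>
    have eq: "(\<Sum>a\<in>X. \<Sum>b\<in>R x. ?A $$ (a, b)) = (\<Sum>a\<in>Y. \<Sum>b\<in>U x. ?f a b)"
      if X: "bij_betw v X Y" "X \<subseteq> {..<w}" for X Y
    proof -
      have "(\<Sum>a\<in>X. \<Sum>b\<in>R x. ?A $$ (a, b)) = (\<Sum>a\<in>X. \<Sum>b\<in>R x. ?f (v a) (v b))"
        using X(2) by (intro sum.cong refl A) (auto simp: R_def)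
      also have "\<dots> = (\<Sum>a\<in>X. \<Sum>b\<in>U x. ?f (v a) b)"
        by (intro sum.cong refl sum.reindex_bij_betw bijR \<open>x < m\<close>)
      also have "\<dots> = (\<Sum>a\<in>Y. \<Sum>b\<in>U x. ?f a b)"
        by (rule sum.reindex_bij_betw[OF X(1), where g = "\<lambda>a. \<Sum>b\<in>U x. ?f a b"])
      finally show ?thesis .
    qed
    have "R x \<subseteq> {..<w}"
      by (auto simp: R_def)
    then show ?thesis
      using card_incident_edges[OF sensing UN[OF that]] eq[OF nodes] eq[OF bijR[OF that]]
      by (simp add: phi_def U_def)
  qed
  have M: "ones_form (delete_indices (zero_indices x ?B) ?A) = (\<Sum>a\<in>R x. \<Sum>b\<in>R x. ?A $$ (a, b))"
    if "x < m" for x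
  proof -
    \<comment> \<open>Since \<open>x\<close> is a user index, column \<open>x\<close> is the
      indicator of \<open>R x\<close>, so deletion keeps just these rows and columns.\<close>
    have "{..<w} - zero_indices x ?B = R x"
      using that \<open>m \<le> w\<close> B by (auto simp: zero_indices_def R_def)
    then show ?thesis
      by (simp add: ones_form_delete_indices A_mat_def)
  qed
  have C: "ones_form (C_mat w v V E1 E2 s i) = (\<Sum>x<m. \<Sum>a<w. \<Sum>b\<in>R x. ?A $$ (a, b))"
  proof -
    have "ones_form (C_mat w v V E1 E2 s i) =
        (\<Sum>a<w. \<Sum>x<w. \<Sum>b<w. ?A $$ (a, b) * ?B $$ (b, x))"
      unfolding ones_form_eq_sum C_mat_def
      by (simp add: A_mat_def scalar_prod_def lessThan_atLeast0)
    \<comment> \<open>Columns of nodes without users are zero in \<open>?B\<close> and contribute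
      nothing to the product.\<close>
    also have "\<dots> = (\<Sum>a<w. \<Sum>x<w. if x < m then \<Sum>b\<in>R x. ?A $$ (a, b) else 0)"
    proof (intro sum.cong refl)
      fix a x assume "x \<in> {..<w}"
      then have "(\<Sum>b<w. ?A $$ (a, b) * ?B $$ (b, x)) =
          (\<Sum>b<w. if b \<in> R x then if x < m then ?A $$ (a, b) else 0 else 0)"
        by (intro sum.cong) (auto simp: B)
      also have "\<dots> = (\<Sum>b\<in>{..<w} \<inter> R x. if x < m then ?A $$ (a, b) else 0)"
        by (simp add: sum.inter_restrict)
      also have "{..<w} \<inter> R x = R x"
        by (auto simp: R_def)
      finally show "(\<Sum>b<w. ?A $$ (a, b) * ?B $$ (b, x)) =
          (if x < m then \<Sum>b\<in>R x. ?A $$ (a, b) else 0)"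
        by simp
    qed
    also have "\<dots> = (\<Sum>a<w. \<Sum>x<m. \<Sum>b\<in>R x. ?A $$ (a, b))"
      using \<open>m \<le> w\<close> by (intro sum.cong refl sum.mono_neutral_cong_right) auto
    also have "\<dots> = (\<Sum>x<m. \<Sum>a<w. \<Sum>b\<in>R x. ?A $$ (a, b))"
      by (rule sum.swap)
    finally show ?thesis .
  qed
  have "(\<Sum>x\<in>V. real (phi E1 E2 (s ` {1..i}) x)) = (\<Sum>x<m. real (phi E1 E2 (s ` {1..i}) (v x)))"
    by (rule sum.reindex_bij_betw[OF users, symmetric])
  also have "\<dots> = ones_form (C_mat w v V E1 E2 s i)
      - (\<Sum>x<m. ones_form (delete_indices (zero_indices x ?B) ?A)) / 2"
    \<comment> \<open>Without \<open>del: One_nat_def\<close>, the simplifier would rewrite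
      \<open>{1..i}\<close> in the goal and \<open>phi_eq\<close> would no longer match.\<close>
    by (simp add: phi_eq M C sum_subtractf sum_divide_distrib del: One_nat_def)
  finally show ?thesis
    by (simp add: Phi_def cardV diff_divide_distrib mult.commute del: One_nat_def)
qed

end
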